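(* Let $K$ be a field of characteristic $0$, let $t\in\mathbb{N}=\{0,1,2,\dots\}$, let $\gamma_1,\dots,\gamma_t\in K$ be nonzero, and let $\mathcal{E}_t=\left(\frac{\gamma_1,\dots,\gamma_t}{K}\right)$ be the algebra obtained from $K$ by applying the Cayley-Dickson process $t$ times with parameters $\gamma_1,\dots,\gamma_t$. Then $\mathcal{E}_t$ is a twisted group algebra for the group $G=\mathbb{Z}_2^{t}$ over the field $K$.
   Context: Cayley-Dickson process: given a finite-dimensional unitary (not necessarily associative) $K$-algebra $\mathcal{E}$ with a scalar involution $a\mapsto\overline{a}$ (a $K$-linear map with $\overline{ab}=\overline{b}\,\overline{a}$, $\overline{\overline{a}}=a$, and $a+\overline{a},\,a\overline{a}\in K\cdot 1$ for all $a,b$) and a nonzero $\gamma\in K$, the algebra $(\mathcal{E},\gamma)$ is the vector space $\mathcal{E}\oplus\mathcal{E}$ with multiplication $(a_1,a_2)(b_1,b_2)=(a_1b_1+\gamma\overline{b_2}a_2,\ a_2\overline{b_1}+b_2a_1)$ and scalar involution $\overline{(a_1,a_2)}=(\overline{a_1},-a_2)$. Set $\mathcal{E}_0=K$ with the identity involution and $\mathcal{E}_{m}=(\mathcal{E}_{m-1},\gamma_{m})$ for $1\le m\le t$; so $\dim_K\mathcal{E}_t=2^t$. Twisted group algebra: for a finite group $(G,\cdot)$ and a field $K$, a twisted group algebra for $G$ over $K$ is a (not necessarily associative) algebra over $K$ with a basis $\{a_g : g\in G\}$ such that for all $g,h\in G$, $a_ga_h=f(g,h)\,a_{g\cdot h}$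 with $f(g,h)\in K$, $f(g,h)\neq 0$. *)

theory Defs
  imports
    "HOL-Algebra.Algebra"
    "Jordan_Normal_Form.Missing_VectorSpace"
begin

section \<open>Not necessarily associative algebras\<close>

text \<open>
  The locale \<^locale>\<open>algebra\<close> of HOL-Algebra requires a commutative ring, so bilinearity of the
  product is stated directly on top of a vector space. Neither associativity nor a unit is assumed.
\<close>

locale nonassoc_algebra = vectorspace K A for K and A (structure) +
  assumes mult_closed:
      "\<lbrakk>x \<in> carrier A; y \<in> carrier A\<rbrakk> \<Longrightarrow> x \<otimes> y \<in> carrier A"
    and mult_add_left:
      "\<lbrakk>x \<in> carrier A; y \<in> carrier A; z \<in> carrier A\<rbrakk> \<Longrightarrow>
        (x \<oplus> y) \<otimes> z = (x \<otimes> z) \<oplus> (y \<otimes> z)"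
    and mult_add_right:
      "\<lbrakk>x \<in> carrier A; y \<in> carrier A; z \<in> carrier A\<rbrakk> \<Longrightarrow>
        x \<otimes> (y \<oplus> z) = (x \<otimes> y) \<oplus> (x \<otimes> z)"
    and mult_smult_left:
      "\<lbrakk>c \<in> carrier K; x \<in> carrier A; y \<in> carrier A\<rbrakk> \<Longrightarrow>
        (c \<odot> x) \<otimes> y = c \<odot> (x \<otimes> y)"
    and mult_smult_right:
      "\<lbrakk>c \<in> carrier K; x \<in> carrier A; y \<in> carrier A\<rbrakk> \<Longrightarrow>
        x \<otimes> (c \<odot> y) = c \<odot> (x \<otimes> y)"

definition twisted_group_algebra ::
    "('g, 'm) monoid_scheme \<Rightarrow> ('a, 'n) ring_scheme \<Rightarrow> ('a, 'e, 'l) module_scheme \<Rightarrow> bool" where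
  "twisted_group_algebra G K A \<longleftrightarrow>
     group G \<and> finite (carrier G) \<and> nonassoc_algebra K A \<and>
     (\<exists>a f. inj_on a (carrier G) \<and> vectorspace.basis K A (a ` carrier G) \<and>
        (\<forall>g \<in> carrier G. \<forall>h \<in> carrier G.
           f g h \<in> carrier K \<and> f g h \<noteq> \<zero>\<^bsub>K\<^esub> \<and>
           a g \<otimes>\<^bsub>A\<^esub> a h = f g h \<odot>\<^bsub>A\<^esub> a (g \<otimes>\<^bsub>G\<^esub> h)))"

section \<open>The Cayley-Dickson process\<close>

record ('a, 'b) inv_algebra = "('a, 'b) module" +
  invol :: "'b \<Rightarrow> 'b"

text \<open>
  A single type closed under formation of pairs, so that all iterated doublings live in one type:
  the elements of the \<open>t\<close>-th algebra are the complete binary trees of depth \<open>t\<close> whose leaves are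
  scalars. The selectors are only ever applied to pairs when they are used in \<open>cd_double\<close>
  below on elements of the carrier.
\<close>

datatype 'a cd_elem =
    Scalar (scalar: 'a)
  | Pair (left: "'a cd_elem") (right: "'a cd_elem")

definition cd_base :: "('a, 'n) ring_scheme \<Rightarrow> ('a, 'a cd_elem) inv_algebra" where
  "cd_base K =
    \<lparr>carrier = Scalar ` carrier K,
     monoid.mult = (\<lambda>x y. Scalar (scalar x \<otimes>\<^bsub>K\<^esub> scalar y)),
     monoid.one = Scalar \<one>\<^bsub>K\<^esub>,
     ring.zero = Scalar \<zero>\<^bsub>K\<^esub>,
     ring.add = (\<lambda>x y. Scalar (scalar x \<oplus>\<^bsub>K\<^esub> scalar y)),
     smult = (\<lambda>c x. Scalar (c \<otimes>\<^bsub>K\<^esub> scalar x)),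
     invol = (\<lambda>x. x)\<rparr>"

definition cd_double ::
    "('a, 'e cd_elem) inv_algebra \<Rightarrow> 'a \<Rightarrow> ('a, 'e cd_elem) inv_algebra" where
  "cd_double E \<gamma> =
    \<lparr>carrier = {Pair x y | x y. x \<in> carrier E \<and> y \<in> carrier E},
     monoid.mult = (\<lambda>a b. Pair
        ((left a \<otimes>\<^bsub>E\<^esub> left b) \<oplus>\<^bsub>E\<^esub> (\<gamma> \<odot>\<^bsub>E\<^esub> (invol E (right b) \<otimes>\<^bsub>E\<^esub> right a)))
        ((right a \<otimes>\<^bsub>E\<^esub> invol E (left b)) \<oplus>\<^bsub>E\<^esub> (right b \<otimes>\<^bsub>E\<^esub> left a))),
     monoid.one = Pair \<one>\<^bsub>E\<^esub> \<zero>\<^bsub>E\<^esub>,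
     ring.zero = Pair \<zero>\<^bsub>E\<^esub> \<zero>\<^bsub>E\<^esub>,
     ring.add = (\<lambda>a b. Pair (left a \<oplus>\<^bsub>E\<^esub> left b) (right a \<oplus>\<^bsub>E\<^esub> right b)),
     smult = (\<lambda>c a. Pair (c \<odot>\<^bsub>E\<^esub> left a) (c \<odot>\<^bsub>E\<^esub> right a)),
     invol = (\<lambda>a. Pair (invol E (left a)) (\<ominus>\<^bsub>E\<^esub> right a))\<rparr>"

primrec cayley_dickson ::
    "('a, 'n) ring_scheme \<Rightarrow> (nat \<Rightarrow> 'a) \<Rightarrow> nat \<Rightarrow> ('a, 'a cd_elem) inv_algebra" where
  "cayley_dickson K \<gamma> 0 = cd_base K"
| "cayley_dickson K \<gamma> (Suc m) = cd_double (cayley_dickson K \<gamma> m) (\<gamma> (Suc m))"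

end

theory Submission
  imports Defs
begin

text \<open>
  Each doubling replaces \<open>E\<close> by \<open>E \<oplus> E\<close>, so the scalar \<open>1\<close> gives rise, after \<open>t\<close> doublings, to
  \<open>2\<^sup>t\<close> units: at step \<open>i\<close> a unit is put either into the left or into the right summand, and an
  element \<open>g\<close> of \<open>\<int>\<^sub>2\<^sup>t\<close> records these choices. Evaluating the doubled product on units \<open>x\<close>, \<open>y\<close> of
  \<open>E\<close>, all but one of the terms vanish:
  \<open>(x,0)(y,0) = (xy,0)\<close>, \<open>(x,0)(0,y) = (0,yx)\<close>, \<open>(0,x)(y,0) = (0,x y\<^sup>*)\<close>, \<open>(0,x)(0,y) = (\<gamma> y\<^sup>* x,0)\<close>,
  where \<open>y\<^sup>*\<close> is the conjugate of \<open>y\<close>.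
  So the choices add up modulo \<open>2\<close>. Conjugation only rescales a unit by a nonzero scalar, the
  order of the factors does not matter to the index because \<open>\<int>\<^sub>2\<^sup>t\<close> is commutative, and \<open>\<gamma>\<close> is
  nonzero; by induction a product of two units is a nonzero multiple of the unit indexed
  by the sum (\<open>cd_unit_mult\<close>).

  The units form a basis. They generate because each subspace of \<open>E \<oplus> E\<close> that contains
  all units of both summands contains both summands (\<open>carrier_le_if_units\<close>); they are independent
  because reading off the leaf at the position described by \<open>g\<close> is a linear functional which is \<open>1\<close>
  on the unit of index \<open>g\<close> and \<open>0\<close> on all others (\<open>dual_family_lin_indpt\<close>).
\<close>

section \<open>Doubling preserves bilinearity\<close>

text \<open>
  The invariant of the doubling process: in the doubled product each summand is bilinear as soon as
  the product is bilinear and the conjugation is linear, and the new conjugation is again linear.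
\<close>

locale conjugation_algebra = nonassoc_algebra K E
  for K and E :: "('a, 'b) inv_algebra" +
  assumes invol_closed: "x \<in> carrier E \<Longrightarrow> invol E x \<in> carrier E"
    and invol_add: "\<lbrakk>x \<in> carrier E; y \<in> carrier E\<rbrakk> \<Longrightarrow>
      invol E (x \<oplus>\<^bsub>E\<^esub> y) = invol E x \<oplus>\<^bsub>E\<^esub> invol E y"
    and invol_smult: "\<lbrakk>c \<in> carrier K; x \<in> carrier E\<rbrakk> \<Longrightarrow>
      invol E (c \<odot>\<^bsub>E\<^esub> x) = c \<odot>\<^bsub>E\<^esub> invol E x"
begin

lemma mult_zero_left: "x \<in> carrier E \<Longrightarrow> \<zero>\<^bsub>E\<^esub> \<otimes>\<^bsub>E\<^esub> x = \<zero>\<^bsub>E\<^esub>"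
  by (metis R.zero_closed mult_closed mult_smult_left smult_l_null)

lemma mult_zero_right: "x \<in> carrier E \<Longrightarrow> x \<otimes>\<^bsub>E\<^esub> \<zero>\<^bsub>E\<^esub> = \<zero>\<^bsub>E\<^esub>"
  by (metis R.zero_closed mult_closed mult_smult_right smult_l_null)

lemma invol_zero: "invol E \<zero>\<^bsub>E\<^esub> = \<zero>\<^bsub>E\<^esub>"
  by (metis M.zero_closed R.zero_closed invol_closed invol_smult smult_l_null)

end

lemma conjugation_algebra_cd_base:
  assumes "field K"
  shows "conjugation_algebra K (cd_base K)"
proof -
  interpret K: field K by fact
  have "abelian_group (cd_base K)"
  proof (rule abelian_groupI)
    show "\<exists>y\<in>carrier (cd_base K). y \<oplus>\<^bsub>cd_base K\<^esub> x = \<zero>\<^bsub>cd_base K\<^esub>"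
      if "x \<in> carrier (cd_base K)" for x
      using that K.l_neg by (fastforce simp: cd_base_def)
  qed (auto simp: cd_base_def K.a_ac)
  then have "module K (cd_base K)"
    by (intro moduleI K.is_cring)
       (auto simp: cd_base_def K.l_distr K.r_distr K.m_assoc)
  then interpret vectorspace K "cd_base K"
    by (simp add: vectorspace_def assms)
  show ?thesis
    by unfold_locales
       (auto simp: cd_base_def K.l_distr K.r_distr K.m_assoc K.m_lcomm)
qed

lemma cd_double_simps [simp]:
  "Pair x y \<in> carrier (cd_double E \<gamma>) \<longleftrightarrow> x \<in> carrier E \<and> y \<in> carrier E"
  "\<zero>\<^bsub>cd_double E \<gamma>\<^esub> = Pair \<zero>\<^bsub>E\<^esub> \<zero>\<^bsub>E\<^esub>"
  "Pair x y \<oplus>\<^bsub>cd_double E \<gamma>\<^esub> Pair x' y' = Pair (x \<oplus>\<^bsub>E\<^esub> x') (y \<oplus>\<^bsub>E\<^esub> y')"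
  "c \<odot>\<^bsub>cd_double E \<gamma>\<^esub> Pair x y = Pair (c \<odot>\<^bsub>E\<^esub> x) (c \<odot>\<^bsub>E\<^esub> y)"
  "invol (cd_double E \<gamma>) (Pair x y) = Pair (invol E x) (\<ominus>\<^bsub>E\<^esub> y)"
  "Pair x y \<otimes>\<^bsub>cd_double E \<gamma>\<^esub> Pair x' y' = Pair
     (x \<otimes>\<^bsub>E\<^esub> x' \<oplus>\<^bsub>E\<^esub> \<gamma> \<odot>\<^bsub>E\<^esub> (invol E y' \<otimes>\<^bsub>E\<^esub> y))
     (y \<otimes>\<^bsub>E\<^esub> invol E x' \<oplus>\<^bsub>E\<^esub> y' \<otimes>\<^bsub>E\<^esub> x)"
  by (simp_all add: cd_double_def)

lemma carrier_cd_doubleE: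
  assumes "z \<in> carrier (cd_double E \<gamma>)"
  obtains x y where "z = Pair x y" "x \<in> carrier E" "y \<in> carrier E"
  using assms by (auto simp: cd_double_def)

lemma conjugation_algebra_cd_double:
  fixes E :: "('a, 'e cd_elem) inv_algebra"
  assumes "conjugation_algebra K E" and \<gamma>: "\<gamma> \<in> carrier K"
  shows "conjugation_algebra K (cd_double E \<gamma>)"
proof -
  interpret conjugation_algebra K E by fact
  let ?D = "cd_double E \<gamma>"
  have "abelian_group ?D"
  proof (rule abelian_groupI)
    show "\<exists>y\<in>carrier ?D. y \<oplus>\<^bsub>?D\<^esub> x = \<zero>\<^bsub>?D\<^esub>" if "x \<in> carrier ?D" for x
    proof -
      from that obtain u v where x: "x = Pair u v" "u \<in> carrier E" "v \<in> carrier E"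
        by (rule carrier_cd_doubleE)
      then have "Pair (\<ominus>\<^bsub>E\<^esub> u) (\<ominus>\<^bsub>E\<^esub> v) \<oplus>\<^bsub>?D\<^esub> x = \<zero>\<^bsub>?D\<^esub>"
        by (simp add: M.l_neg)
      with x show ?thesis
        by (intro bexI[where x = "Pair (\<ominus>\<^bsub>E\<^esub> u) (\<ominus>\<^bsub>E\<^esub> v)"]) auto
    qed
  qed (auto elim!: carrier_cd_doubleE simp: M.a_ac)
  then have "module K ?D"
    by (intro moduleI R.is_cring)
       (auto elim!: carrier_cd_doubleE simp: smult_l_distr smult_r_distr smult_assoc1)
  then interpret D: vectorspace K ?D
    by (simp add: vectorspace_def field_axioms)
  show ?thesis
  proof (unfold_locales, goal_cases)
    case (1 x y)
    then show ?case
      by (auto elim!: carrier_cd_doubleE simp: \<gamma> mult_closed invol_closed)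
  next
    case (2 x y z)
    then show ?case
      by (auto elim!: carrier_cd_doubleE simp: \<gamma> mult_closed invol_closed
          mult_add_left mult_add_right invol_add smult_r_distr M.a_ac)
  next
    case (3 x y z)
    then show ?case
      by (auto elim!: carrier_cd_doubleE simp: \<gamma> mult_closed invol_closed
          mult_add_left mult_add_right invol_add smult_r_distr M.a_ac)
  next
    case (4 c x y)
    then show ?case
      by (auto elim!: carrier_cd_doubleE simp: \<gamma> mult_closed invol_closed
          mult_smult_left mult_smult_right invol_smult smult_r_distr
          smult_assoc1[symmetric] R.m_comm)
  next
    case (5 c x y)
    then show ?case
      by (auto elim!: carrier_cd_doubleE simp: \<gamma> mult_closed invol_closed
          mult_smult_left mult_smult_right invol_smult smult_r_distr
          smult_assoc1[symmetric] R.m_comm)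
  next
    case (6 x)
    then show ?case
      by (auto elim!: carrier_cd_doubleE simp: invol_closed)
  next
    case (7 x y)
    then show ?case
      by (auto elim!: carrier_cd_doubleE simp: invol_add M.minus_add M.a_comm)
  next
    case (8 c x)
    then show ?case
      by (auto elim!: carrier_cd_doubleE simp: invol_smult smult_r_minus)
  qed
qed

lemma conjugation_algebra_cayley_dickson:
  assumes "field K" and "\<And>i. i \<in> {1..m} \<Longrightarrow> \<gamma> i \<in> carrier K"
  shows "conjugation_algebra K (cayley_dickson K \<gamma> m)"
  using assms(2)
  by (induction m)
     (simp_all add: conjugation_algebra_cd_base[OF assms(1)] conjugation_algebra_cd_double)

section \<open>The units and their products\<close>

text \<open>
  Only the parities of \<open>g 1, \<dots>, g m\<close> are used. This way every integer function is an index, and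
  addition of indices is pointwise addition of functions without reduction modulo \<open>2\<close>.
\<close>

primrec cd_unit ::
    "('a, 'n) ring_scheme \<Rightarrow> (nat \<Rightarrow> 'a) \<Rightarrow> nat \<Rightarrow> (nat \<Rightarrow> int) \<Rightarrow> 'a cd_elem" where
  "cd_unit K \<gamma> 0 g = Scalar \<one>\<^bsub>K\<^esub>"
| "cd_unit K \<gamma> (Suc m) g =
    (if even (g (Suc m)) then Pair (cd_unit K \<gamma> m g) \<zero>\<^bsub>cayley_dickson K \<gamma> m\<^esub>
     else Pair \<zero>\<^bsub>cayley_dickson K \<gamma> m\<^esub> (cd_unit K \<gamma> m g))"

lemma cd_unit_cong:
  assumes "\<And>i. i \<in> {1..m} \<Longrightarrow> even (g i) \<longleftrightarrow> even (h i)"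
  shows "cd_unit K \<gamma> m g = cd_unit K \<gamma> m h"
  using assms by (induction m) auto

lemma cd_unit_closed:
  assumes "field K" and "\<And>i. i \<in> {1..m} \<Longrightarrow> \<gamma> i \<in> carrier K"
  shows "cd_unit K \<gamma> m g \<in> carrier (cayley_dickson K \<gamma> m)"
  using assms(2)
proof (induction m)
  case 0
  interpret field K by fact
  show ?case by (simp add: cd_base_def)
next
  case (Suc m)
  then interpret conjugation_algebra K "cayley_dickson K \<gamma> m"
    by (intro conjugation_algebra_cayley_dickson \<open>field K\<close>) auto
  show ?case using Suc by simp
qed

text \<open>
  A unit in the right summand is negated; one in the left summand inherits the scalar of the
  previous stage, since the conjugation of the double acts there as the previous one.
\<close>

lemma cd_unit_invol:
  assumes "field K" and "\<And>i. i \<in> {1..m} \<Longrightarrow> \<gamma> i \<in> carrier K"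
  shows "\<exists>s \<in> carrier K - {\<zero>\<^bsub>K\<^esub>}. invol (cayley_dickson K \<gamma> m) (cd_unit K \<gamma> m g) =
           s \<odot>\<^bsub>cayley_dickson K \<gamma> m\<^esub> cd_unit K \<gamma> m g"
  using assms(2)
proof (induction m)
  case 0
  interpret field K by fact
  show ?case by (auto simp: cd_base_def intro!: bexI[of _ "\<one>\<^bsub>K\<^esub>"])
next
  case (Suc m)
  let ?E = "cayley_dickson K \<gamma> m"
  interpret conjugation_algebra K ?E
    using Suc.prems by (intro conjugation_algebra_cayley_dickson \<open>field K\<close>) auto
  have e: "cd_unit K \<gamma> m g \<in> carrier ?E"
    using Suc.prems by (intro cd_unit_closed \<open>field K\<close>) auto
  obtain s where s: "s \<in> carrier K" "s \<noteq> \<zero>\<^bsub>K\<^esub>"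
    "invol ?E (cd_unit K \<gamma> m g) = s \<odot>\<^bsub>?E\<^esub> cd_unit K \<gamma> m g"
    using Suc by fastforce
  show ?case
  proof (cases "even (g (Suc m))")
    case True
    with s show ?thesis by (auto intro!: bexI[of _ s])
  next
    case False
    have "\<ominus>\<^bsub>K\<^esub> \<one>\<^bsub>K\<^esub> \<noteq> \<zero>\<^bsub>K\<^esub>"
      using R.add.inv_eq_1_iff[of "\<one>\<^bsub>K\<^esub>"] by simp
    with e False show ?thesis
      by (intro bexI[of _ "\<ominus>\<^bsub>K\<^esub> \<one>\<^bsub>K\<^esub>"]) (simp_all add: invol_zero smult_l_minus)
  qed
qed

text \<open>
  Four cases according to the summands that contain the two factors. If the second factor lies
  right, the doubled product multiplies the components in reverse order, so the induction
  hypothesis is applied to the swapped product, which changes the scalar but not the index.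
\<close>

lemma cd_unit_mult:
  assumes "field K" and "\<And>i. i \<in> {1..m} \<Longrightarrow> \<gamma> i \<in> carrier K \<and> \<gamma> i \<noteq> \<zero>\<^bsub>K\<^esub>"
  shows "\<exists>c \<in> carrier K - {\<zero>\<^bsub>K\<^esub>}.
           cd_unit K \<gamma> m g \<otimes>\<^bsub>cayley_dickson K \<gamma> m\<^esub> cd_unit K \<gamma> m h =
           c \<odot>\<^bsub>cayley_dickson K \<gamma> m\<^esub> cd_unit K \<gamma> m (\<lambda>i. g i + h i)"
  using assms(2)
proof (induction m arbitrary: g h)
  case 0
  interpret field K by fact
  show ?case by (auto simp: cd_base_def intro!: bexI[of _ "\<one>\<^bsub>K\<^esub>"])
next
  case (Suc m)
  let ?E = "cayley_dickson K \<gamma> m" and ?e = "cd_unit K \<gamma> m"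
  let ?gh = "\<lambda>i. g i + h i"
  interpret conjugation_algebra K ?E
    using Suc.prems by (intro conjugation_algebra_cayley_dickson \<open>field K\<close>) auto
  have e: "?e k \<in> carrier ?E" for k
    using Suc.prems by (intro cd_unit_closed \<open>field K\<close>) auto
  have \<gamma>: "\<gamma> (Suc m) \<in> carrier K" "\<gamma> (Suc m) \<noteq> \<zero>\<^bsub>K\<^esub>"
    using Suc.prems by auto
  have IH: "\<exists>c \<in> carrier K - {\<zero>\<^bsub>K\<^esub>}. ?e k \<otimes>\<^bsub>?E\<^esub> ?e l = c \<odot>\<^bsub>?E\<^esub> ?e (\<lambda>i. k i + l i)" for k l
    using Suc by auto
  obtain c where c: "c \<in> carrier K" "c \<noteq> \<zero>\<^bsub>K\<^esub>" "?e g \<otimes>\<^bsub>?E\<^esub> ?e h = c \<odot>\<^bsub>?E\<^esub> ?e ?gh"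
    using IH by blast
  obtain d where d: "d \<in> carrier K" "d \<noteq> \<zero>\<^bsub>K\<^esub>" "?e h \<otimes>\<^bsub>?E\<^esub> ?e g = d \<odot>\<^bsub>?E\<^esub> ?e ?gh"
    using IH[of h g] by (auto simp: add.commute)
  obtain s where s: "s \<in> carrier K" "s \<noteq> \<zero>\<^bsub>K\<^esub>" "invol ?E (?e h) = s \<odot>\<^bsub>?E\<^esub> ?e h"
    using cd_unit_invol[OF \<open>field K\<close>, of m \<gamma> h] Suc.prems by auto
  note zero = mult_zero_left mult_zero_right invol_zero invol_closed e
  consider (ll) "even (g (Suc m))" "even (h (Suc m))" | (lr) "even (g (Suc m))" "odd (h (Suc m))"
    | (rl) "odd (g (Suc m))" "even (h (Suc m))" | (rr) "odd (g (Suc m))" "odd (h (Suc m))"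
    by blast
  then show ?case
  proof cases
    case ll
    with c \<gamma> show ?thesis by (auto simp: zero intro!: bexI[of _ c])
  next
    case lr
    with d \<gamma> show ?thesis by (auto simp: zero intro!: bexI[of _ d])
  next
    case rl
    with s c \<gamma> show ?thesis
      by (intro bexI[of _ "s \<otimes>\<^bsub>K\<^esub> c"])
         (simp_all add: zero mult_smult_right smult_assoc1 integral_iff)
  next
    case rr
    with s d \<gamma> show ?thesis
      by (intro bexI[of _ "\<gamma> (Suc m) \<otimes>\<^bsub>K\<^esub> (s \<otimes>\<^bsub>K\<^esub> d)"])
         (simp_all add: zero mult_smult_left smult_assoc1 integral_iff)
  qed
qed

section \<open>The units form a basis\<close>

text \<open>
  Generation is stated through all subspaces containing the units, since this is the form that
  passes to the summands: for a subspace \<open>N\<close> of the double, the \<open>x\<close> with \<open>(x,0)\<close> in \<open>N\<close> form a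
  subspace of the original algebra, and so do the \<open>y\<close> with \<open>(0,y)\<close> in \<open>N\<close>.
\<close>

lemma carrier_le_if_units:
  assumes "field K" and "\<And>i. i \<in> {1..m} \<Longrightarrow> \<gamma> i \<in> carrier K"
    and "LinearCombinations.submodule K N (cayley_dickson K \<gamma> m)"
    and "\<And>g. cd_unit K \<gamma> m g \<in> N"
  shows "carrier (cayley_dickson K \<gamma> m) \<subseteq> N"
  using assms(2-4)
proof (induction m arbitrary: N)
  case 0
  interpret field K by fact
  show ?case
  proof
    fix x assume "x \<in> carrier (cayley_dickson K \<gamma> 0)"
    then obtain k where k: "k \<in> carrier K" "x = Scalar k" by (auto simp: cd_base_def)
    then have "x = k \<odot>\<^bsub>cd_base K\<^esub> Scalar \<one>\<^bsub>K\<^esub>" by (simp add: cd_base_def)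
    moreover have "k \<odot>\<^bsub>cd_base K\<^esub> Scalar \<one>\<^bsub>K\<^esub> \<in> N"
      using 0 k(1) by (simp add: LinearCombinations.submodule_def)
    ultimately show "x \<in> N" by simp
  qed
next
  case (Suc m)
  let ?E = "cayley_dickson K \<gamma> m" and ?e = "cd_unit K \<gamma> m" and ?D = "cayley_dickson K \<gamma> (Suc m)"
  interpret conjugation_algebra K ?E
    using Suc.prems by (intro conjugation_algebra_cayley_dickson \<open>field K\<close>) auto
  have add: "v \<oplus>\<^bsub>?D\<^esub> w \<in> N" if "v \<in> N" "w \<in> N" for v w
    using Suc.prems(2) that by (simp add: LinearCombinations.submodule_def)
  have zero: "\<zero>\<^bsub>?D\<^esub> \<in> N"
    using Suc.prems(2) by (simp add: LinearCombinations.submodule_def)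
  have smult: "c \<odot>\<^bsub>?D\<^esub> v \<in> N" if "c \<in> carrier K" "v \<in> N" for c v
    using Suc.prems(2) that by (simp add: LinearCombinations.submodule_def)
  have "carrier ?E \<subseteq> {x \<in> carrier ?E. Pair x \<zero>\<^bsub>?E\<^esub> \<in> N}"
  proof (rule Suc.IH)
    show "LinearCombinations.submodule K {x \<in> carrier ?E. Pair x \<zero>\<^bsub>?E\<^esub> \<in> N} ?E"
      unfolding LinearCombinations.submodule_def
      using add[of "Pair _ \<zero>\<^bsub>?E\<^esub>" "Pair _ \<zero>\<^bsub>?E\<^esub>"] zero smult[of _ "Pair _ \<zero>\<^bsub>?E\<^esub>"] module_axioms
      by auto
    show "?e g \<in> {x \<in> carrier ?E. Pair x \<zero>\<^bsub>?E\<^esub> \<in> N}" for g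
    proof -
      have "?e (g(Suc m := 0)) = ?e g" by (rule cd_unit_cong) auto
      then have "Pair (?e g) \<zero>\<^bsub>?E\<^esub> \<in> N"
        using Suc.prems(3)[of "g(Suc m := 0)"] by (simp del: fun_upd_apply add: fun_upd_same)
      moreover have "?e g \<in> carrier ?E"
        using Suc.prems(1) by (intro cd_unit_closed \<open>field K\<close>) auto
      ultimately show ?thesis by simp
    qed
  qed (use Suc.prems in auto)
  moreover have "carrier ?E \<subseteq> {y \<in> carrier ?E. Pair \<zero>\<^bsub>?E\<^esub> y \<in> N}"
  proof (rule Suc.IH)
    show "LinearCombinations.submodule K {y \<in> carrier ?E. Pair \<zero>\<^bsub>?E\<^esub> y \<in> N} ?E"
      unfolding LinearCombinations.submodule_def
      using add[of "Pair \<zero>\<^bsub>?E\<^esub> _" "Pair \<zero>\<^bsub>?E\<^esub> _"] zero smult[of _ "Pair \<zero>\<^bsub>?E\<^esub> _"] module_axioms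
      by auto
    show "?e g \<in> {y \<in> carrier ?E. Pair \<zero>\<^bsub>?E\<^esub> y \<in> N}" for g
    proof -
      have "?e (g(Suc m := 1)) = ?e g" by (rule cd_unit_cong) auto
      then have "Pair \<zero>\<^bsub>?E\<^esub> (?e g) \<in> N"
        using Suc.prems(3)[of "g(Suc m := 1)"] by (simp del: fun_upd_apply add: fun_upd_same)
      moreover have "?e g \<in> carrier ?E"
        using Suc.prems(1) by (intro cd_unit_closed \<open>field K\<close>) auto
      ultimately show ?thesis by simp
    qed
  qed (use Suc.prems in auto)
  ultimately show ?case
    using add[of "Pair _ \<zero>\<^bsub>?E\<^esub>" "Pair \<zero>\<^bsub>?E\<^esub> _"] by (fastforce elim!: carrier_cd_doubleE)
qed

text \<open>
  The leaf that the parities of \<open>g m, \<dots>, g 1\<close> lead to, that is, the coefficient of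
  \<^term>\<open>cd_unit K \<gamma> m g\<close>.
\<close>

primrec cd_coord :: "nat \<Rightarrow> (nat \<Rightarrow> int) \<Rightarrow> 'a cd_elem \<Rightarrow> 'a" where
  "cd_coord 0 g x = scalar x"
| "cd_coord (Suc m) g x = cd_coord m g (if even (g (Suc m)) then left x else right x)"

lemma cd_coord_zero: "cd_coord m g \<zero>\<^bsub>cayley_dickson K \<gamma> m\<^esub> = \<zero>\<^bsub>K\<^esub>"
  by (induction m) (auto simp: cd_base_def)

lemma cd_coord_closed:
  "x \<in> carrier (cayley_dickson K \<gamma> m) \<Longrightarrow> cd_coord m g x \<in> carrier K"
  by (induction m arbitrary: x) (auto simp: cd_base_def elim!: carrier_cd_doubleE)

lemma cd_coord_add:
  "cd_coord m g (x \<oplus>\<^bsub>cayley_dickson K \<gamma> m\<^esub> y) = cd_coord m g x \<oplus>\<^bsub>K\<^esub> cd_coord m g y"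
  by (induction m arbitrary: x y) (auto simp: cd_base_def cd_double_def)

lemma cd_coord_smult:
  "cd_coord m g (c \<odot>\<^bsub>cayley_dickson K \<gamma> m\<^esub> x) = c \<otimes>\<^bsub>K\<^esub> cd_coord m g x"
  by (induction m arbitrary: x) (auto simp: cd_base_def cd_double_def)

lemma cd_coord_unit:
  "cd_coord m g (cd_unit K \<gamma> m h) =
     (if \<forall>i\<in>{1..m}. even (g i) \<longleftrightarrow> even (h i) then \<one>\<^bsub>K\<^esub> else \<zero>\<^bsub>K\<^esub>)"
proof (induction m)
  case (Suc m)
  have "{1..Suc m} = insert (Suc m) {1..m}" by auto
  with Suc show ?case by (auto simp: cd_coord_zero)
qed auto

text \<open>
  Applying the functional dual to \<open>b i\<close> to a vanishing linear combination leaves only the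
  coefficient of \<open>b i\<close>.
\<close>

lemma (in vectorspace) dual_family_lin_indpt:
  assumes "finite I" and b: "\<And>i. i \<in> I \<Longrightarrow> b i \<in> carrier V"
    and closed: "\<And>i x. \<lbrakk>i \<in> I; x \<in> carrier V\<rbrakk> \<Longrightarrow> \<phi> i x \<in> carrier K"
    and add: "\<And>i x y. \<lbrakk>i \<in> I; x \<in> carrier V; y \<in> carrier V\<rbrakk> \<Longrightarrow>
      \<phi> i (x \<oplus>\<^bsub>V\<^esub> y) = \<phi> i x \<oplus>\<^bsub>K\<^esub> \<phi> i y"
    and smult: "\<And>i c x. \<lbrakk>i \<in> I; c \<in> carrier K; x \<in> carrier V\<rbrakk> \<Longrightarrow>
      \<phi> i (c \<odot>\<^bsub>V\<^esub> x) = c \<otimes>\<^bsub>K\<^esub> \<phi> i x"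
    and dual: "\<And>i j. \<lbrakk>i \<in> I; j \<in> I\<rbrakk> \<Longrightarrow> \<phi> i (b j) = (if i = j then \<one>\<^bsub>K\<^esub> else \<zero>\<^bsub>K\<^esub>)"
  shows "inj_on b I" and "\<not> lin_dep (b ` I)"
proof -
  show inj: "inj_on b I"
    using dual by (metis inj_onI one_not_zero)
  show "\<not> lin_dep (b ` I)"
  proof (rule finite_lin_indpt2)
    fix a assume a: "a \<in> b ` I \<rightarrow> carrier K" and 0: "lincomb a (b ` I) = \<zero>\<^bsub>V\<^esub>"
    show "\<forall>v\<in>b ` I. a v = \<zero>\<^bsub>K\<^esub>"
    proof clarify
      fix i assume i: "i \<in> I"
      have "\<phi> i (\<zero>\<^bsub>K\<^esub> \<odot>\<^bsub>V\<^esub> \<zero>\<^bsub>V\<^esub>) = \<zero>\<^bsub>K\<^esub> \<otimes>\<^bsub>K\<^esub> \<phi> i \<zero>\<^bsub>V\<^esub>"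
        using i by (intro smult) auto
      then have phi0: "\<phi> i \<zero>\<^bsub>V\<^esub> = \<zero>\<^bsub>K\<^esub>"
        using i closed by simp
      have "\<phi> i (\<Oplus>\<^bsub>V\<^esub>j\<in>J. a (b j) \<odot>\<^bsub>V\<^esub> b j) = (if i \<in> J then a (b i) else \<zero>\<^bsub>K\<^esub>)"
        if "finite J" "J \<subseteq> I" for J
        using that
      proof (induction J)
        case empty
        then show ?case using phi0 by simp
      next
        case (insert j J)
        have ab: "a (b k) \<in> carrier K" "b k \<in> carrier V" if "k \<in> I" for k
          using that a b by auto
        have "\<phi> i (\<Oplus>\<^bsub>V\<^esub>k\<in>insert j J. a (b k) \<odot>\<^bsub>V\<^esub> b k) =
          a (b j) \<otimes>\<^bsub>K\<^esub> \<phi> i (b j) \<oplus>\<^bsub>K\<^esub> \<phi> i (\<Oplus>\<^bsub>V\<^esub>k\<in>J. a (b k) \<odot>\<^bsub>V\<^esub> b k)"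
        proof -
          have "(\<Oplus>\<^bsub>V\<^esub>k\<in>J. a (b k) \<odot>\<^bsub>V\<^esub> b k) \<in> carrier V"
            using insert ab by (intro M.finsum_closed) auto
          moreover have "(\<Oplus>\<^bsub>V\<^esub>k\<in>insert j J. a (b k) \<odot>\<^bsub>V\<^esub> b k) =
              a (b j) \<odot>\<^bsub>V\<^esub> b j \<oplus>\<^bsub>V\<^esub> (\<Oplus>\<^bsub>V\<^esub>k\<in>J. a (b k) \<odot>\<^bsub>V\<^esub> b k)"
            using insert ab by (intro M.finsum_insert) auto
          ultimately show ?thesis
            using insert ab i by (simp add: add smult)
        qed
        then show ?case
          using insert ab i by (auto simp: dual)
      qed
      from this[OF \<open>finite I\<close>] i
      have "\<phi> i (\<Oplus>\<^bsub>V\<^esub>j\<in>I. a (b j) \<odot>\<^bsub>V\<^esub> b j) = a (b i)" by simp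
      moreover have "lincomb a (b ` I) = (\<Oplus>\<^bsub>V\<^esub>j\<in>I. a (b j) \<odot>\<^bsub>V\<^esub> b j)"
        unfolding lincomb_def using a b by (intro M.finsum_reindex inj) auto
      ultimately show "a (b i) = \<zero>\<^bsub>K\<^esub>"
        using 0 phi0 by simp
    qed
  qed (use assms in auto)
qed

lemma carrier_Z2_power:
  "carrier (product_group {1..t} (\<lambda>_. integer_mod_group 2)) = {1..t} \<rightarrow>\<^sub>E {0, 1}"
proof -
  have "{0..<2} = {0, 1 :: int}" by auto
  then show ?thesis by (simp add: carrier_integer_mod_group)
qed

lemma parity_eq_iff:
  assumes "g \<in> I \<rightarrow>\<^sub>E {0, 1 :: int}" "h \<in> I \<rightarrow>\<^sub>E {0, 1}"
  shows "(\<forall>i\<in>I. even (g i) \<longleftrightarrow> even (h i)) \<longleftrightarrow> g = h"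
proof
  assume *: "\<forall>i\<in>I. even (g i) \<longleftrightarrow> even (h i)"
  show "g = h"
  proof (rule PiE_ext[OF assms])
    fix i assume "i \<in> I"
    with * assms have "even (g i) \<longleftrightarrow> even (h i)" "g i \<in> {0, 1}" "h i \<in> {0, 1}" by auto
    then show "g i = h i" by auto
  qed
qed simp

lemma cd_unit_basis:
  assumes "field K" and \<gamma>: "\<And>i. i \<in> {1..t} \<Longrightarrow> \<gamma> i \<in> carrier K"
  defines "I \<equiv> {1..t} \<rightarrow>\<^sub>E {0, 1}"
  shows "inj_on (cd_unit K \<gamma> t) I"
    and "vectorspace.basis K (cayley_dickson K \<gamma> t) (cd_unit K \<gamma> t ` I)"
proof -
  let ?E = "cayley_dickson K \<gamma> t" and ?e = "cd_unit K \<gamma> t"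
  interpret conjugation_algebra K ?E
    using assms by (intro conjugation_algebra_cayley_dickson)
  have fin: "finite I" by (simp add: I_def finite_PiE)
  have e: "?e g \<in> carrier ?E" for g
    using assms by (intro cd_unit_closed)
  have dual: "cd_coord t g (?e h) = (if g = h then \<one>\<^bsub>K\<^esub> else \<zero>\<^bsub>K\<^esub>)" if "g \<in> I" "h \<in> I" for g h
    using parity_eq_iff[of g "{1..t}" h] that unfolding I_def by (simp add: cd_coord_unit)
  note indpt = dual_family_lin_indpt[of I ?e "cd_coord t", OF fin e cd_coord_closed cd_coord_add
      cd_coord_smult dual]
  show "inj_on ?e I" by (rule indpt)
  have sub: "?e ` I \<subseteq> carrier ?E" using e by auto
  have "carrier ?E \<subseteq> span (?e ` I)"
  proof (rule carrier_le_if_units[OF \<open>field K\<close> \<gamma> span_is_submodule[OF sub]])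
    fix g :: "nat \<Rightarrow> int"
    let ?h = "\<lambda>i\<in>{1..t}. g i mod 2"
    have "?h \<in> I" by (auto simp: I_def)
    moreover have "?e g = ?e ?h" by (intro cd_unit_cong) auto
    ultimately show "?e g \<in> span (?e ` I)"
      using in_own_span[OF sub] by auto
  qed
  then have "span (?e ` I) = carrier ?E"
    using span_closed[OF sub] by auto
  with sub indpt(2) show "basis (?e ` I)"
    by (simp add: basis_def)
qed

theorem theorem2p8:
  fixes K :: "('a, 'n) ring_scheme" and t :: nat and \<gamma> :: "nat \<Rightarrow> 'a"
  assumes "field K"
    and "\<And>n::nat. n > 0 \<Longrightarrow> [n] \<cdot>\<^bsub>K\<^esub> \<one>\<^bsub>K\<^esub> \<noteq> \<zero>\<^bsub>K\<^esub>"
    and "\<And>i. i \<in> {1..t} \<Longrightarrow> \<gamma> i \<in> carrier K \<and> \<gamma> i \<noteq> \<zero>\<^bsub>K\<^esub>"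
  shows "twisted_group_algebra (product_group {1..t} (\<lambda>_. integer_mod_group 2)) K
           (cayley_dickson K \<gamma> t)"
proof -
  let ?G = "product_group {1..t} (\<lambda>_. integer_mod_group 2)"
  let ?E = "cayley_dickson K \<gamma> t" and ?e = "cd_unit K \<gamma> t"
  have \<gamma>: "\<And>i. i \<in> {1..t} \<Longrightarrow> \<gamma> i \<in> carrier K" using assms(3) by blast
  interpret conjugation_algebra K ?E
    using assms(1) \<gamma> by (rule conjugation_algebra_cayley_dickson)
  have sum: "?e (\<lambda>i. g i + h i) = ?e (g \<otimes>\<^bsub>?G\<^esub> h)" for g h
    by (intro cd_unit_cong) simp
  have "\<exists>c. c \<in> carrier K \<and> c \<noteq> \<zero>\<^bsub>K\<^esub> \<and> ?e g \<otimes>\<^bsub>?E\<^esub> ?e h = c \<odot>\<^bsub>?E\<^esub> ?e (g \<otimes>\<^bsub>?G\<^esub> h)" for g h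
    using cd_unit_mult[where \<gamma> = \<gamma> and m = t and g = g and h = h, OF assms(1,3)]
    unfolding sum[of g h] by blast
  then obtain f where f: "\<And>g h. f g h \<in> carrier K \<and> f g h \<noteq> \<zero>\<^bsub>K\<^esub> \<and>
      ?e g \<otimes>\<^bsub>?E\<^esub> ?e h = f g h \<odot>\<^bsub>?E\<^esub> ?e (g \<otimes>\<^bsub>?G\<^esub> h)"
    by metis
  show ?thesis
    unfolding twisted_group_algebra_def
  proof (intro conjI exI[of _ ?e] exI[of _ f] ballI)
    show "group ?G" by simp
    show "finite (carrier ?G)"
      unfolding carrier_Z2_power by (simp add: finite_PiE)
    show "nonassoc_algebra K ?E" by (rule nonassoc_algebra_axioms)
    show "inj_on ?e (carrier ?G)" "basis (?e ` carrier ?G)"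
      unfolding carrier_Z2_power using cd_unit_basis[where \<gamma> = \<gamma> and t = t, OF assms(1) \<gamma>] by simp_all
  qed (use f in blast)+
qed

end
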